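(* Let $G=(V,w,\mu,d)$ be a finite connected weighted graph equipped with a general path distance $d$, and suppose $G$ has non-negative Ollivier curvature. Suppose there exists a vertex $x\in V$ such that $\kappa(x,y)>0$ for all $y\in S_1^{comb}(x)$. Then $\beta_1(M_2(G))=0$.
   Context: A finite weighted graph $G=(V,w,\mu,d)$ consists of a finite vertex set $V$, a symmetric edge weight $w:V\times V\to[0,\infty)$ vanishing on the diagonal, a vertex weight $\mu:V\to(0,\infty)$, and a general path distance $d$. Write $x\sim y$ iff $w(x,y)>0$; $G$ is connected. A general path distance is a symmetric $d:V\times V\to[0,\infty)$ with $d(x,y)=0$ iff $x=y$ and $d(x,y)=\inf\{\sum_{k=1}^n d(x_{k-1},x_k): x=x_0\sim x_1\sim\dots\sim x_n=y\}$ for all $x,y$. $S_1^{comb}(x)=\{y: y\sim x\}$. The Laplacian is $\Delta f(x)=\sum_{y}\frac{w(x,y)}{\mu(x)}(f(y)-f(x))$. For $x\neq y$ let $\nabla_{xy}f=\frac{f(x)-f(y)}{d(x,y)}$ and $\|\nabla f\|_\infty=\sup_{x\neq y}|\nabla_{xy}f|$. The Ollivier curvature of distinct vertices $x,y$ is $\kappa(x,y)=\inf\{\nabla_{xy}\Delta f: f:V\to\mathbb R,\ \nabla_{yx}f=1,\ \|\nabla f\|_\infty=1\}$; $G$ has non-negative Ollivier curvature if $\kappa(x,y)\ge 0$ for all $x\sim y$. The complex $M_2(G)$: a 1-form is a function $\alpha$ on ordered pairs of adjacent vertices with $\alpha(y,x)=-\alpha(x,y)$. A cycle is a sequence $(x_0\sim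 x_1\sim\dots\sim x_{n-1})$ of distinct vertices with $n\ge 3$ and $x_{n-1}\sim x_0$, considered up to cyclic rotation and reversal. $X_2$ is the set of cycles admitting a labeling $(x_0\sim\dots\sim x_{n-1})$ such that either $n=3$, or $d(x_0,x_3)<d(x_0,x_1)+d(x_1,x_2)+d(x_2,x_3)$ and the path $x_3\sim x_4\sim\dots\sim x_{n-1}\sim x_0$ is a geodesic (the sum of $d$ along consecutive vertices equals $d(x_3,x_0)$). For a 1-form $\alpha$ set $\delta\alpha(c)=\sum_{i=0}^{n-1}\alpha(x_i,x_{i+1 \bmod n})$ for $c=(x_0\sim\dots\sim x_{n-1})\in X_2$, and $\delta^*\alpha(x)=\sum_{y\sim x}\frac{w(x,y)}{\mu(x)}\alpha(x,y)$. Then $H_1(M_2(G))=\{\alpha: \delta\alpha(c)=0\ \forall c\in X_2,\ \delta^*\alpha\equiv 0\}$ and $\beta_1(M_2(G))=\dim H_1(M_2(G))$. *)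

theory Defs
  imports "HOL-Analysis.Analysis"
begin

text \<open>
  The finite vertex set is the universe of a type of class \<open>finite\<close>; \<open>w\<close> is the edge weight,
  \<open>\<mu>\<close> the vertex weight and \<open>d\<close> the distance.
\<close>

definition adj :: "('v \<Rightarrow> 'v \<Rightarrow> real) \<Rightarrow> 'v \<Rightarrow> 'v \<Rightarrow> bool" where
  "adj w x y \<longleftrightarrow> w x y > 0"

definition S1_comb :: "('v \<Rightarrow> 'v \<Rightarrow> real) \<Rightarrow> 'v \<Rightarrow> 'v set" where
  "S1_comb w x = {y. adj w y x}"

fun path_length :: "('v \<Rightarrow> 'v \<Rightarrow> real) \<Rightarrow> 'v list \<Rightarrow> real" where
  "path_length d (x # y # xs) = d x y + path_length d (y # xs)"
| "path_length d _ = 0"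

text \<open>The one-vertex list is the path with \<open>n = 0\<close> edges from a vertex to itself.\<close>

definition paths :: "('v \<Rightarrow> 'v \<Rightarrow> real) \<Rightarrow> 'v \<Rightarrow> 'v \<Rightarrow> 'v list set" where
  "paths w x y = {xs. xs \<noteq> [] \<and> hd xs = x \<and> last xs = y \<and> successively (adj w) xs}"

definition general_path_distance :: "('v \<Rightarrow> 'v \<Rightarrow> real) \<Rightarrow> ('v \<Rightarrow> 'v \<Rightarrow> real) \<Rightarrow> bool" where
  "general_path_distance w d \<longleftrightarrow>
     (\<forall>x y. d x y \<ge> 0) \<and>
     (\<forall>x y. d x y = d y x) \<and>
     (\<forall>x y. d x y = 0 \<longleftrightarrow> x = y) \<and>
     (\<forall>x y. d x y = (INF xs\<in>paths w x y. path_length d xs))"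

locale connected_weighted_graph =
  fixes w :: "'v::finite \<Rightarrow> 'v \<Rightarrow> real"
    and \<mu> :: "'v \<Rightarrow> real"
    and d :: "'v \<Rightarrow> 'v \<Rightarrow> real"
  assumes w_nonneg: "w x y \<ge> 0"
    and w_sym: "w x y = w y x"
    and w_diag: "w x x = 0"
    and \<mu>_pos: "\<mu> x > 0"
    and path_distance: "general_path_distance w d"
    and connected: "paths w x y \<noteq> {}"

definition laplacian ::
    "('v::finite \<Rightarrow> 'v \<Rightarrow> real) \<Rightarrow> ('v \<Rightarrow> real) \<Rightarrow> ('v \<Rightarrow> real) \<Rightarrow> 'v \<Rightarrow> real" where
  "laplacian w \<mu> f x = (\<Sum>y\<in>UNIV. w x y / \<mu> x * (f y - f x))"

definition grad :: "('v \<Rightarrow> 'v \<Rightarrow> real) \<Rightarrow> 'v \<Rightarrow> 'v \<Rightarrow> ('v \<Rightarrow> real) \<Rightarrow> real" where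
  "grad d x y f = (f x - f y) / d x y"

definition grad_norm :: "('v \<Rightarrow> 'v \<Rightarrow> real) \<Rightarrow> ('v \<Rightarrow> real) \<Rightarrow> real" where
  "grad_norm d f = (SUP (x, y) \<in> {(x, y). x \<noteq> y}. \<bar>grad d x y f\<bar>)"

definition curvature ::
    "('v::finite \<Rightarrow> 'v \<Rightarrow> real) \<Rightarrow> ('v \<Rightarrow> real) \<Rightarrow> ('v \<Rightarrow> 'v \<Rightarrow> real) \<Rightarrow> 'v \<Rightarrow> 'v \<Rightarrow> real" where
  "curvature w \<mu> d x y =
     Inf {grad d x y (laplacian w \<mu> f) | f. grad d y x f = 1 \<and> grad_norm d f = 1}"

definition nonneg_curvature ::
    "('v::finite \<Rightarrow> 'v \<Rightarrow> real) \<Rightarrow> ('v \<Rightarrow> real) \<Rightarrow> ('v \<Rightarrow> 'v \<Rightarrow> real) \<Rightarrow> bool" where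
  "nonneg_curvature w \<mu> d \<longleftrightarrow> (\<forall>x y. adj w x y \<longrightarrow> curvature w \<mu> d x y \<ge> 0)"

text \<open>
  A 1-form lives on ordered adjacent pairs only; it is encoded as a vector indexed by all ordered
  pairs that vanishes on the non-adjacent ones, so that the library dimension applies.
\<close>

definition one_forms :: "('v::finite \<Rightarrow> 'v \<Rightarrow> real) \<Rightarrow> (real ^ ('v \<times> 'v)) set" where
  "one_forms w = {\<alpha>. (\<forall>x y. adj w x y \<longrightarrow> \<alpha> $ (y, x) = - \<alpha> $ (x, y)) \<and>
                     (\<forall>x y. \<not> adj w x y \<longrightarrow> \<alpha> $ (x, y) = 0)}"

definition labelled_cycle :: "('v \<Rightarrow> 'v \<Rightarrow> real) \<Rightarrow> 'v list \<Rightarrow> bool" where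
  "labelled_cycle w xs \<longleftrightarrow>
     length xs \<ge> 3 \<and> distinct xs \<and> successively (adj w) xs \<and> adj w (last xs) (hd xs)"

definition same_cycle :: "'v list \<Rightarrow> 'v list \<Rightarrow> bool" where
  "same_cycle xs ys \<longleftrightarrow> (\<exists>k. ys = rotate k xs \<or> ys = rotate k (rev xs))"

text \<open>
  A cycle (a class modulo rotation and reversal) is represented by all of its labellings: \<open>X2\<close> is
  the set of all labellings of cycles of which at least one labelling satisfies the condition.
\<close>

definition X2 :: "('v \<Rightarrow> 'v \<Rightarrow> real) \<Rightarrow> ('v \<Rightarrow> 'v \<Rightarrow> real) \<Rightarrow> 'v list set" where
  "X2 w d = {c. labelled_cycle w c \<and>
     (\<exists>x. same_cycle c x \<and>
        (length x = 3 \<or>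
         length x > 3 \<and>
         d (x ! 0) (x ! 3) < d (x ! 0) (x ! 1) + d (x ! 1) (x ! 2) + d (x ! 2) (x ! 3) \<and>
         path_length d (drop 3 x @ [x ! 0]) = d (x ! 3) (x ! 0)))}"

definition coboundary :: "real ^ ('v::finite \<times> 'v) \<Rightarrow> 'v list \<Rightarrow> real" where
  "coboundary \<alpha> c = (\<Sum>i<length c. \<alpha> $ (c ! i, c ! ((i + 1) mod length c)))"

definition codifferential ::
    "('v::finite \<Rightarrow> 'v \<Rightarrow> real) \<Rightarrow> ('v \<Rightarrow> real) \<Rightarrow> real ^ ('v \<times> 'v) \<Rightarrow> 'v \<Rightarrow> real" where
  "codifferential w \<mu> \<alpha> x = (\<Sum>y | adj w y x. w x y / \<mu> x * \<alpha> $ (x, y))"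

definition H1 ::
    "('v::finite \<Rightarrow> 'v \<Rightarrow> real) \<Rightarrow> ('v \<Rightarrow> real) \<Rightarrow> ('v \<Rightarrow> 'v \<Rightarrow> real) \<Rightarrow> (real ^ ('v \<times> 'v)) set" where
  "H1 w \<mu> d = {\<alpha> \<in> one_forms w.
     (\<forall>c\<in>X2 w d. coboundary \<alpha> c = 0) \<and> (\<forall>x. codifferential w \<mu> \<alpha> x = 0)}"

definition betti1 ::
    "('v::finite \<Rightarrow> 'v \<Rightarrow> real) \<Rightarrow> ('v \<Rightarrow> real) \<Rightarrow> ('v \<Rightarrow> 'v \<Rightarrow> real) \<Rightarrow> nat" where
  "betti1 w \<mu> d = dim (H1 w \<mu> d)"

lemma coboundary_add: "coboundary (\<alpha> + \<beta>) c = coboundary \<alpha> c + coboundary \<beta> c"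
  and coboundary_scaleR: "coboundary (r *\<^sub>R \<alpha>) c = r * coboundary \<alpha> c"
  by (simp_all add: coboundary_def sum.distrib sum_distrib_left)

lemma codifferential_add:
    "codifferential w \<mu> (\<alpha> + \<beta>) x = codifferential w \<mu> \<alpha> x + codifferential w \<mu> \<beta> x"
  by (simp add: codifferential_def sum.distrib distrib_left)

lemma codifferential_scaleR:
    "codifferential w \<mu> (r *\<^sub>R \<alpha>) x = r * codifferential w \<mu> \<alpha> x"
  unfolding codifferential_def sum_distrib_left by (intro sum.cong) auto

lemma subspace_one_forms: "subspace (one_forms w)"
  by (auto simp: subspace_def one_forms_def)

lemma subspace_H1: "subspace (H1 w \<mu> d)"
proof -
  have "coboundary 0 c = 0" "codifferential w \<mu> 0 x = 0" for c :: "'a list" and x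
    by (simp_all add: coboundary_def codifferential_def)
  thus ?thesis
    using subspace_one_forms[of w]
    by (simp add: subspace_def H1_def coboundary_add coboundary_scaleR
        codifferential_add codifferential_scaleR)
qed

lemma path_length_append:
  "path_length d (xs @ z # ys) = path_length d (xs @ [z]) + path_length d (z # ys)"
  by (induction xs rule: induct_list012) auto

context connected_weighted_graph
begin

lemma d_nonneg: "d x y \<ge> 0" and d_sym: "d x y = d y x" and d_eq_0: "d x y = 0 \<longleftrightarrow> x = y"
  and d_eq_INF: "d x y = (INF xs\<in>paths w x y. path_length d xs)"
proof -
  note * = path_distance[unfolded general_path_distance_def]
  show "d x y \<ge> 0" by (rule *[THEN conjunct1, rule_format])
  show "d x y = d y x" by (rule *[THEN conjunct2, THEN conjunct1, rule_format])
  show "d x y = 0 \<longleftrightarrow> x = y" by (rule *[THEN conjunct2, THEN conjunct2, THEN conjunct1, rule_format])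
  show "d x y = (INF xs\<in>paths w x y. path_length d xs)"
    by (rule *[THEN conjunct2, THEN conjunct2, THEN conjunct2, rule_format])
qed

lemma path_length_nonneg: "path_length d xs \<ge> 0"
  by (induction xs rule: induct_list012) (auto simp: d_nonneg)

lemma bdd_below_path_lengths: "bdd_below (path_length d ` paths w x y)"
  using path_length_nonneg by (auto intro!: bdd_belowI[of _ 0])

lemma d_triangle: "d x z \<le> d x y + d y z"
proof -
  have step: "d x z \<le> path_length d p + path_length d q"
    if "p \<in> paths w x y" "q \<in> paths w y z" for p q
  proof -
    have p: "p = butlast p @ [y]" and hd_p: "hd p = x" and succ_p: "successively (adj w) p"
      using that(1) append_butlast_last_id[of p] by (auto simp: paths_def)
    have q: "q = y # tl q" and last_q: "last q = z" and succ_q: "successively (adj w) q"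
      using that(2) list.collapse[of q] by (auto simp: paths_def)
    define p' q' where "p' = butlast p" and "q' = tl q"
    have p: "p = p' @ [y]" and q: "q = y # q'"
      using p q unfolding p'_def q'_def by blast+
    have "hd (p' @ y # q') = x" using hd_p p by (cases p') auto
    moreover have "last (p' @ y # q') = z" using last_q q by simp
    moreover have "successively (adj w) (p' @ y # q')"
      using succ_p succ_q unfolding p q by (simp add: successively_append_iff)
    ultimately have "p' @ y # q' \<in> paths w x z"
      by (simp add: paths_def)
    hence "d x z \<le> path_length d (p' @ y # q')"
      unfolding d_eq_INF[of x z] by (rule cINF_lower[OF bdd_below_path_lengths])
    thus ?thesis using path_length_append[of d p' y q'] p q by simp
  qed
  have "d x z - path_length d p \<le> d y z" if "p \<in> paths w x y" for p
    unfolding d_eq_INF[of y z] using step[OF that] connected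
    by (intro cINF_greatest) (auto simp: algebra_simps)
  hence "d x z - d y z \<le> d x y"
    unfolding d_eq_INF[of x y] using connected
    by (intro cINF_greatest) (auto simp: algebra_simps)
  thus ?thesis by simp
qed

lemma bdd_above_grad: "bdd_above ((\<lambda>(x, y). \<bar>grad d x y f\<bar>) ` {(x, y). x \<noteq> y})"
  by (intro bdd_above_finite finite_imageI) simp

lemma grad_norm_Lipschitz:
  assumes "grad_norm d f = 1"
  shows "\<bar>f x - f y\<bar> \<le> d x y"
proof (cases "x = y")
  case False
  have "\<bar>grad d x y f\<bar> \<le> 1"
    using cSUP_upper[OF _ bdd_above_grad, of "(x, y)" f] assms False
    unfolding grad_norm_def by auto
  thus ?thesis using False d_nonneg[of x y] d_eq_0[of x y]
    by (auto simp: grad_def divide_simps split: if_splits)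
qed (simp add: d_nonneg)

text \<open>
  The infimum defining the curvature is taken over a nonempty set bounded below.
\<close>

lemma curvature_set_nonempty:
  assumes "x \<noteq> y"
  shows "grad d y x (d x) = 1 \<and> grad_norm d (d x) = 1"
proof
  have pos: "d u v > 0" if "u \<noteq> v" for u v
    using that d_nonneg[of u v] d_eq_0[of u v] by linarith
  show 1: "grad d y x (d x) = 1"
    using pos[OF assms] d_sym[of x y] d_eq_0[of x x] by (simp add: grad_def)
  have "\<bar>grad d u v (d x)\<bar> \<le> 1" if "u \<noteq> v" for u v
    using pos[OF that] d_triangle[of x u v] d_triangle[of x v u] d_sym[of u v]
    by (auto simp: grad_def divide_simps)
  hence "grad_norm d (d x) \<le> 1"
    unfolding grad_norm_def using assms by (intro cSUP_least) auto
  moreover have "1 \<le> grad_norm d (d x)"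
    using cSUP_upper[OF _ bdd_above_grad, of "(y, x)" "d x"] assms 1
    unfolding grad_norm_def by auto
  ultimately show "grad_norm d (d x) = 1" by simp
qed

lemma curvature_set_bdd_below:
  "bdd_below {grad d x y (laplacian w \<mu> f) | f. grad d y x f = 1 \<and> grad_norm d f = 1}"
proof -
  define B where "B u = (\<Sum>v\<in>UNIV. w u v / \<mu> u * d v u)" for u
  have lap: "\<bar>laplacian w \<mu> f u\<bar> \<le> B u" if "grad_norm d f = 1" for f u
    unfolding laplacian_def B_def
  proof (rule order.trans[OF sum_abs], rule sum_mono)
    fix v
    have "0 \<le> w u v / \<mu> u" using w_nonneg[of u v] \<mu>_pos[of u] by simp
    thus "\<bar>w u v / \<mu> u * (f v - f u)\<bar> \<le> w u v / \<mu> u * d v u"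
      using mult_left_mono[OF grad_norm_Lipschitz[OF that, of v u]]
      by (simp only: abs_mult abs_of_nonneg)
  qed
  have "- (B x + B y) / d x y \<le> grad d x y (laplacian w \<mu> f)" if "grad_norm d f = 1" for f
    unfolding grad_def using lap[OF that, of x] lap[OF that, of y]
    by (intro divide_right_mono) (auto simp: d_nonneg)
  thus ?thesis by (auto intro!: bdd_belowI)
qed

end

end

theory Submission
  imports Defs
begin

text \<open>
  Normalise a nonzero harmonic form so that \<open>\<alpha> \<le> d\<close> on edges, with equality somewhere, and call
  the edges with equality tight. The cycles in \<open>X\<^sub>2\<close> are exactly what is needed to deform every walk
  \<open>z \<sim> x \<sim> y \<sim> z'\<close> to a geodesic with the same \<open>\<alpha>\<close>-sum; so \<open>\<alpha>\<close> has a harmonic 1-Lipschitz primitive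
  near each edge, and \<open>\<kappa> \<le> 0\<close> on tight edges. If moreover \<open>\<kappa>(x, y) \<ge> 0\<close> for a tight edge, linear
  programming duality matches each neighbour of \<open>x\<close> with a vertex of the ball around \<open>y\<close> along a
  walk of tight edges. Tight walks can therefore be transported to neighbouring starting points,
  with bounded change of length. Since they are arbitrarily long from some vertex (otherwise their maximal
  length violates a maximum principle), they are so from every vertex, and every vertex has a
  tight edge, including the one at which all curvatures are positive.
\<close>

section \<open>Coboundaries as sums along closed vertex lists\<close>

lemma path_length_eq_sum:
  "path_length g xs = (\<Sum>i<length xs - 1. g (xs ! i) (xs ! Suc i))"
proof (induction g xs rule: path_length.induct)
  case (1 g x y xs)
  then show ?case
    by (simp add: sum.lessThan_Suc_shift del: sum.lessThan_Suc)
qed auto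

text \<open>Appending the first vertex removes the index modulo \<open>length c\<close>, so sums
  around cycles follow the recursion of \<open>path_length\<close>.\<close>

lemma coboundary_eq_path_length:
  assumes "c \<noteq> []"
  shows "coboundary \<alpha> c = path_length (\<lambda>u v. \<alpha> $ (u, v)) (c @ [hd c])"
  unfolding coboundary_def path_length_eq_sum
proof (rule sum.cong)
  fix i assume "i \<in> {..<length (c @ [hd c]) - 1}"
  hence i: "i < length c" by simp
  have "c ! ((i + 1) mod length c) = (c @ [hd c]) ! Suc i"
  proof (cases "Suc i = length c")
    case True
    thus ?thesis using assms by (simp add: nth_append hd_conv_nth)
  next
    case False
    thus ?thesis using i by (simp add: nth_append)
  qed
  thus "\<alpha> $ (c ! i, c ! ((i + 1) mod length c))
      = \<alpha> $ ((c @ [hd c]) ! i, (c @ [hd c]) ! Suc i)"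
    using i by (simp add: nth_append)
qed simp

section \<open>Geodesics of the path distance\<close>

context connected_weighted_graph
begin

lemma adj_sym: "adj w x y \<longleftrightarrow> adj w y x"
  by (simp add: adj_def w_sym)

lemma not_adj_refl: "\<not> adj w x x"
  by (simp add: adj_def w_diag)

lemma ne_if_adj: "adj w x y \<Longrightarrow> x \<noteq> y"
  using not_adj_refl by blast

lemma d_refl [simp]: "d x x = 0"
  by (simp add: d_eq_0)

lemma d_pos: "x \<noteq> y \<Longrightarrow> d x y > 0"
  using d_nonneg[of x y] d_eq_0[of x y] by linarith

lemma adj_induct:
  assumes "P x" and step: "\<And>u v. adj w u v \<Longrightarrow> P u \<Longrightarrow> P v"
  shows "P y"
proof -
  have "P (last p)" if "p \<noteq> []" "P (hd p)" "successively (adj w) p" for p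
    using that
  proof (induction p rule: induct_list012)
    case (3 x y zs)
    hence "P y" using step[of x y] by simp
    thus ?case using 3 by simp
  qed auto
  moreover obtain p where "p \<in> paths w x y" using connected by blast
  ultimately show ?thesis using \<open>P x\<close> by (auto simp: paths_def)
qed

lemma d_le_path_length: "xs \<noteq> [] \<Longrightarrow> d (hd xs) (last xs) \<le> path_length d xs"
proof (induction xs rule: induct_list012)
  case (3 x y zs)
  thus ?case using d_triangle[of x "last (y # zs)" y] by simp
qed auto

text \<open>Infinitely many walks compete in the infimum, but each is at least its first edge plus
  the remaining distance. Only finitely many such values occur, so one of them realises
  \<open>d x y\<close>.\<close>

lemma geodesic_first_step:
  assumes "x \<noteq> y"
  obtains p where "adj w x p" "d x y = d x p + d p y"
proof -
  define N where "N = (\<lambda>p. d x p + d p y) ` {p. adj w x p}"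
  have long: "\<exists>n\<in>N. n \<le> path_length d q" if q: "q \<in> paths w x y" for q
  proof -
    obtain p r where qr: "q = x # p # r"
      using q assms by (cases q; cases "tl q") (auto simp: paths_def)
    have "adj w x p" using q qr by (auto simp: paths_def)
    moreover have "d p y \<le> path_length d (p # r)"
      using d_le_path_length[of "p # r"] q qr by (auto simp: paths_def)
    ultimately show ?thesis using qr by (auto simp: N_def)
  qed
  obtain q where "q \<in> paths w x y" using connected by blast
  hence N: "finite N" "N \<noteq> {}" using long by (auto simp: N_def)
  have "Min N \<le> d x y"
    unfolding d_eq_INF[of x y]
  proof (rule cINF_greatest[OF connected])
    fix q assume "q \<in> paths w x y"
    then obtain n where "n \<in> N" "n \<le> path_length d q" using long by blast
    thus "Min N \<le> path_length d q" using N Min_le[of N n] by linarith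
  qed
  moreover obtain p where "adj w x p" "Min N = d x p + d p y"
    using Min_in[OF N] by (auto simp: N_def)
  ultimately show ?thesis using that d_triangle[of x y p] by force
qed

lemma geodesic_exists:
  obtains p where "p \<in> paths w x y" "path_length d p = d x y" "distinct p"
proof -
  \<comment> \<open>The last conjunct yields distinctness: the tail stays strictly closer to
    \<open>y\<close> than \<open>x\<close> is, hence avoids \<open>x\<close>.\<close>
  have "\<exists>p. p \<in> paths w x y \<and> path_length d p = d x y \<and> distinct p
      \<and> (\<forall>u\<in>set p. d u y \<le> d x y)"
  proof (induction "card {u. d u y < d x y}" arbitrary: x rule: less_induct)
    case less
    show ?case
    proof (cases "x = y")
      case True
      thus ?thesis by (intro exI[of _ "[x]"]) (auto simp: paths_def)
    next
      case False
      then obtain p where p: "adj w x p" "d x y = d x p + d p y"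
        by (rule geodesic_first_step)
      have "d x p > 0" using p not_adj_refl by (intro d_pos) auto
      hence lt: "d p y < d x y" using p by simp
      have "{u. d u y < d p y} \<subset> {u. d u y < d x y}"
      proof
        show "{u. d u y < d p y} \<subseteq> {u. d u y < d x y}" using lt by auto
        show "{u. d u y < d p y} \<noteq> {u. d u y < d x y}" using lt by force
      qed
      hence "card {u. d u y < d p y} < card {u. d u y < d x y}"
        by (intro psubset_card_mono) auto
      from less[OF this] obtain q where q: "q \<in> paths w p y" "path_length d q = d p y"
        "distinct q" "\<forall>u\<in>set q. d u y \<le> d p y"
        by blast
      obtain r where r: "q = p # r" using q(1) by (cases q) (auto simp: paths_def)
      show ?thesis
        using q p lt unfolding r
        by (intro exI[of _ "x # p # r"]) (force simp: paths_def)
    qed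
  qed
  thus ?thesis using that by blast
qed

lemma d_split_on_geodesic:
  assumes "p \<in> paths w x y" "path_length d p = d x y" "u \<in> set p"
  shows "d x y = d x u + d u y"
proof -
  obtain p1 p2 where p: "p = p1 @ u # p2" using assms(3) by (meson split_list)
  have "d x u \<le> path_length d (p1 @ [u])"
    using d_le_path_length[of "p1 @ [u]"] assms(1) p by (cases p1) (auto simp: paths_def)
  moreover have "d u y \<le> path_length d (u # p2)"
    using d_le_path_length[of "u # p2"] assms(1) p by (auto simp: paths_def)
  ultimately show ?thesis
    using assms(2) p path_length_append[of d p1 u p2] d_triangle[of x y u] by simp
qed

section \<open>Upper bounds for the curvature, maximum principle\<close>

lemma grad_norm_eq_1:
  assumes lip: "\<And>u v. g u - g v \<le> d u v" and "x \<noteq> y" "g y - g x = d x y"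
  shows "grad d y x g = 1" "grad_norm d g = 1"
proof -
  show 1: "grad d y x g = 1"
    using assms(3) d_pos[OF assms(2)] by (simp add: grad_def d_sym[of y x])
  have "\<bar>grad d u v g\<bar> \<le> 1" if "u \<noteq> v" for u v
    using d_pos[OF that] lip[of u v] lip[of v u] d_sym[of u v]
    by (auto simp: grad_def divide_simps)
  hence "grad_norm d g \<le> 1"
    unfolding grad_norm_def using assms by (intro cSUP_least) auto
  moreover have "1 \<le> grad_norm d g"
    using cSUP_upper[OF _ bdd_above_grad, of "(y, x)" g] assms 1
    unfolding grad_norm_def by auto
  ultimately show "grad_norm d g = 1" by simp
qed

lemma curvature_le:
  assumes "\<And>u v. g u - g v \<le> d u v" "x \<noteq> y" "g y - g x = d x y"
  shows "curvature w \<mu> d x y \<le> (laplacian w \<mu> g x - laplacian w \<mu> g y) / d x y"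
proof -
  have "curvature w \<mu> d x y \<le> grad d x y (laplacian w \<mu> g)"
    unfolding curvature_def
    using grad_norm_eq_1[OF assms] by (intro cInf_lower[OF _ curvature_set_bdd_below]) auto
  thus ?thesis by (simp add: grad_def)
qed

lemma laplacian_mono:
  assumes "\<And>z. adj w x z \<Longrightarrow> f z - f x \<le> g z - g x"
  shows "laplacian w \<mu> f x \<le> laplacian w \<mu> g x"
  unfolding laplacian_def
proof (rule sum_mono)
  fix z
  show "w x z / \<mu> x * (f z - f x) \<le> w x z / \<mu> x * (g z - g x)"
  proof (cases "adj w x z")
    case True
    thus ?thesis using assms[of z] \<mu>_pos[of x] by (intro mult_left_mono) (auto simp: adj_def)
  next
    case False
    thus ?thesis using w_nonneg[of x z] by (simp add: adj_def)
  qed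
qed

lemma laplacian_add: "laplacian w \<mu> (\<lambda>z. f z + g z) x = laplacian w \<mu> f x + laplacian w \<mu> g x"
  unfolding laplacian_def sum.distrib[symmetric]
  by (rule sum.cong) (simp_all add: ring_distribs add_divide_distrib diff_divide_distrib)

lemma laplacian_scale: "laplacian w \<mu> (\<lambda>z. c * f z) x = c * laplacian w \<mu> f x"
  unfolding laplacian_def sum_distrib_left
  by (rule sum.cong) (simp_all add: ring_distribs mult.left_commute)

lemma laplacian_const [simp]: "laplacian w \<mu> (\<lambda>_. c) x = 0"
  by (simp add: laplacian_def)

lemma laplacian_strict_neg:
  assumes "\<And>z. adj w x z \<Longrightarrow> f z \<le> f x" "adj w x y" "f y < f x"
  shows "laplacian w \<mu> f x < 0"
proof -
  have nonpos: "w x z / \<mu> x * (f z - f x) \<le> 0" for z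
  proof (cases "adj w x z")
    case True
    thus ?thesis using assms(1)[of z] \<mu>_pos[of x] w_nonneg[of x z]
      by (intro mult_nonneg_nonpos) auto
  next
    case False
    thus ?thesis using w_nonneg[of x z] by (simp add: adj_def)
  qed
  moreover have "w x y / \<mu> x * (f y - f x) < 0"
    using assms(2,3) \<mu>_pos[of x] by (intro mult_pos_neg) (auto simp: adj_def)
  ultimately have "(\<Sum>z\<in>UNIV. w x z / \<mu> x * (f z - f x)) < (\<Sum>z::'v\<in>UNIV. 0)"
    by (intro sum_strict_mono_ex1) auto
  thus ?thesis by (simp add: laplacian_def)
qed

text \<open>The ball is combinatorial, not metric: the Laplacian at \<open>x\<close> depends on the
  values at these vertices.\<close>

definition unit_ball :: "'v \<Rightarrow> 'v set" where
  "unit_ball x = insert x {z. adj w x z}"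

text \<open>
  The McShane extension from the ball around \<open>y\<close> lies below \<open>A\<close> on the ball around \<open>x\<close>, so it is a
  competitor in the infimum defining the curvature.
\<close>

lemma curvature_le_of_potentials:
  assumes "x \<noteq> y"
    and le: "\<And>z z'. z \<in> unit_ball x \<Longrightarrow> z' \<in> unit_ball y \<Longrightarrow> B z' - A z \<le> d z z'"
    and eq: "B y - A x = d x y"
  shows "curvature w \<mu> d x y \<le> (laplacian w \<mu> A x - laplacian w \<mu> B y) / d x y"
proof -
  define g where "g u = Max ((\<lambda>z'. B z' - d u z') ` unit_ball y)" for u
  have fin: "finite ((\<lambda>z'. B z' - d u z') ` unit_ball y)" for u by simp
  have ne: "(\<lambda>z'. B z' - d u z') ` unit_ball y \<noteq> {}" for u by (simp add: unit_ball_def)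
  have ge: "B z' - d u z' \<le> g u" if "z' \<in> unit_ball y" for u z'
    unfolding g_def using that by (intro Max_ge) auto
  have attained: "\<exists>z'\<in>unit_ball y. g u = B z' - d u z'" for u
    using Max_in[OF fin ne, of u] unfolding g_def by auto
  have lip: "g u - g v \<le> d u v" for u v
  proof -
    obtain z' where "z' \<in> unit_ball y" "g u = B z' - d u z'" using attained by blast
    thus ?thesis using ge[of z' v] d_triangle[of v z' u] by (simp add: d_sym[of v u])
  qed
  have g_le: "g z \<le> A z" if "z \<in> unit_ball x" for z
    using attained[of z] le[OF that] by fastforce
  have g_ge: "B z' \<le> g z'" if "z' \<in> unit_ball y" for z'
    using ge[OF that, of z'] by simp
  \<comment> \<open>The chain \<open>d x y = B y - A x \<le> g y - g x \<le> d x y\<close> pins both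
    centre values.\<close>
  have "g x \<le> A x" "B y \<le> g y" using g_le[of x] g_ge[of y] by (simp_all add: unit_ball_def)
  moreover have "g y - g x \<le> d x y" using lip[of y x] by (simp add: d_sym)
  ultimately have gx: "g x = A x" and gy: "g y = B y" using eq by linarith+
  have "laplacian w \<mu> g x \<le> laplacian w \<mu> A x"
    using gx g_le by (intro laplacian_mono) (simp add: unit_ball_def)
  moreover have "laplacian w \<mu> B y \<le> laplacian w \<mu> g y"
    using gy g_ge by (intro laplacian_mono) (simp add: unit_ball_def)
  ultimately have "(laplacian w \<mu> g x - laplacian w \<mu> g y) / d x y
      \<le> (laplacian w \<mu> A x - laplacian w \<mu> B y) / d x y"
    using d_nonneg[of x y] by (intro divide_right_mono) auto
  moreover have "curvature w \<mu> d x y \<le> (laplacian w \<mu> g x - laplacian w \<mu> g y) / d x y"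
    using lip assms(1) eq gx gy by (intro curvature_le) auto
  ultimately show ?thesis by linarith
qed

end

section \<open>Closed forms along geodesics\<close>

locale closed_form = connected_weighted_graph w \<mu> d
  for w :: "'v::finite \<Rightarrow> 'v \<Rightarrow> real" and \<mu> d +
  fixes \<alpha> :: "real ^ ('v \<times> 'v)"
  assumes one_form: "\<alpha> \<in> one_forms w"
    and closed: "c \<in> X2 w d \<Longrightarrow> coboundary \<alpha> c = 0"
begin

abbreviation \<alpha>_length :: "'v list \<Rightarrow> real" where
  "\<alpha>_length \<equiv> path_length (\<lambda>u v. \<alpha> $ (u, v))"

lemma \<alpha>_not_adj: "\<not> adj w x y \<Longrightarrow> \<alpha> $ (x, y) = 0"
  using one_form unfolding one_forms_def by blast

lemma \<alpha>_antisym: "\<alpha> $ (y, x) = - \<alpha> $ (x, y)"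
proof (cases "adj w x y")
  case True
  thus ?thesis using one_form unfolding one_forms_def by blast
next
  case False
  thus ?thesis using \<alpha>_not_adj[of x y] \<alpha>_not_adj[of y x] adj_sym[of x y] by simp
qed

lemma \<alpha>_refl [simp]: "\<alpha> $ (x, x) = 0"
  by (rule \<alpha>_not_adj[OF not_adj_refl])

lemma \<alpha>_length_closed:
  assumes "labelled_cycle w c"
    and "length c = 3 \<or> length c > 3 \<and>
         d (c ! 0) (c ! 3) < d (c ! 0) (c ! 1) + d (c ! 1) (c ! 2) + d (c ! 2) (c ! 3) \<and>
         path_length d (drop 3 c @ [c ! 0]) = d (c ! 3) (c ! 0)"
  shows "\<alpha>_length (c @ [hd c]) = 0"
proof -
  have "same_cycle c c" unfolding same_cycle_def by (rule exI[of _ 0]) simp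
  hence "c \<in> X2 w d" using assms by (auto simp: X2_def)
  moreover have "c \<noteq> []" using assms by (auto simp: labelled_cycle_def)
  ultimately show ?thesis using closed coboundary_eq_path_length[of c \<alpha>] by simp
qed

text \<open>A relation rather than a function: two geodesics with the same ends may carry different
  sums, as around a hexagon with unit edge distances.\<close>

definition geodesic_value :: "'v \<Rightarrow> 'v \<Rightarrow> real \<Rightarrow> bool" where
  "geodesic_value x y s \<longleftrightarrow>
     (\<exists>p\<in>paths w x y. path_length d p = d x y \<and> \<alpha>_length p = s)"

lemma geodesic_value_trans:
  assumes "geodesic_value x y s" "geodesic_value y z t" "d x z = d x y + d y z"
  shows "geodesic_value x z (s + t)"
proof -
  obtain p q where p: "p \<in> paths w x y" "path_length d p = d x y" "\<alpha>_length p = s"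
    and q: "q \<in> paths w y z" "path_length d q = d y z" "\<alpha>_length q = t"
    using assms(1,2) unfolding geodesic_value_def by blast
  obtain q' where q': "q = y # q'" using q(1) by (cases q) (auto simp: paths_def)
  obtain p' where p': "p = p' @ [y]"
    using p(1) by (cases p rule: rev_cases) (auto simp: paths_def)
  have "hd (p' @ y # q') = x" using p(1) p' by (cases p') (auto simp: paths_def)
  moreover have "successively (adj w) (p' @ y # q')"
    using p(1) q(1) unfolding p' q' by (simp add: paths_def successively_append_iff)
  ultimately have "p' @ y # q' \<in> paths w x z"
    using q(1) unfolding q' by (simp add: paths_def)
  thus ?thesis
    using p q assms(3) path_length_append[of _ p' y q'] unfolding geodesic_value_def p' q'
    by (intro bexI[of _ "p' @ y # q'"]) auto
qed

lemma geodesic_value_refl: "geodesic_value x x 0"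
  unfolding geodesic_value_def by (rule bexI[of _ "[x]"]) (auto simp: paths_def)

lemma geodesic_value_edge:
  assumes "adj w x y"
  shows "geodesic_value x y (\<alpha> $ (x, y))"
  unfolding geodesic_value_def using assms
  by (intro bexI[of _ "[x, y]"]) (auto simp: paths_def)

text \<open>If \<open>x\<close> and \<open>y\<close> differ and the two edges are not already a
  geodesic, \<open>m\<close> lies off every geodesic from \<open>x\<close> to \<open>y\<close>, and
  closing the edges up with one gives a cycle of \<open>X2\<close>.\<close>

lemma geodesic_value_two_edges:
  assumes "adj w x m" "adj w m y"
  shows "geodesic_value x y (\<alpha> $ (x, m) + \<alpha> $ (m, y))"
proof (cases "x = y")
  case True
  thus ?thesis using geodesic_value_refl \<alpha>_antisym[of x m] by simp
next
  case xy: False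
  show ?thesis
  proof (cases "d x y = d x m + d m y")
    case True
    thus ?thesis using geodesic_value_trans[OF assms[THEN geodesic_value_edge]] by simp
  next
    case False
    hence lt: "d x y < d x m + d m y" using d_triangle[of x y m] by simp
    obtain p where p: "p \<in> paths w x y" "path_length d p = d x y" "distinct p"
      by (rule geodesic_exists)
    have m: "m \<notin> set p" using d_split_on_geodesic[OF p(1,2)] lt by fastforce
    obtain r where r: "p = x # r @ [y]"
      using p(1) xy
      by (cases p; cases "tl p" rule: rev_cases) (auto simp: paths_def)
    \<comment> \<open>With \<open>y\<close> first, the three edges compared in \<open>X2\<close> are
      \<open>y m\<close>, \<open>m x\<close> and the first edge of the geodesic, whose remainder is
      again a geodesic. An empty \<open>r\<close> gives a triangle.\<close>
    define c where "c = y # m # x # r"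
    have "successively (adj w) ((x # r) @ [y])" using p(1) r by (simp add: paths_def)
    hence "successively (adj w) (x # r)" "adj w (last (x # r)) y"
      unfolding successively_append_iff by simp_all
    hence "labelled_cycle w c"
      using p(3) m assms ne_if_adj[OF assms(2)] unfolding c_def r
      by (auto simp: labelled_cycle_def adj_sym[of y m] adj_sym[of m x])
    moreover have "length c = 3 \<or> length c > 3 \<and>
         d (c ! 0) (c ! 3) < d (c ! 0) (c ! 1) + d (c ! 1) (c ! 2) + d (c ! 2) (c ! 3) \<and>
         path_length d (drop 3 c @ [c ! 0]) = d (c ! 3) (c ! 0)"
    proof (cases r)
      case (Cons u s)
      have "u \<in> set p" using r Cons by simp
      hence "d x y = d x u + d u y" using d_split_on_geodesic[OF p(1,2)] by simp
      moreover have "path_length d p = d x u + path_length d (u # s @ [y])"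
        using r Cons by simp
      moreover have "d x u \<ge> 0" by (rule d_nonneg)
      ultimately show ?thesis using lt p(2) Cons
        by (simp add: c_def d_sym[of y] d_sym[of m x])
    qed (simp add: c_def)
    ultimately have "\<alpha>_length (c @ [hd c]) = 0" by (rule \<alpha>_length_closed)
    hence "\<alpha>_length p = \<alpha> $ (x, m) + \<alpha> $ (m, y)"
      using \<alpha>_antisym[of y m] \<alpha>_antisym[of m x] by (simp add: c_def r)
    thus ?thesis using p unfolding geodesic_value_def by blast
  qed
qed

text \<open>A backtracking walk cancels to one edge, and a closed one is a triangle. Otherwise the
  distance splits at \<open>x\<close> or \<open>y\<close>, leaving a two-edge walk to treat, or a
  geodesic closes the reversed walk up to a cycle of \<open>X2\<close>.\<close>

lemma geodesic_value_three_edges: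
  assumes "adj w z x" "adj w x y" "adj w y z'"
  shows "geodesic_value z z' (\<alpha> $ (z, x) + \<alpha> $ (x, y) + \<alpha> $ (y, z'))"
proof -
  note ne = assms[THEN ne_if_adj]
  consider "z = y" | "z' = x" | "z = z'" "z \<noteq> y" | "z \<noteq> y" "z' \<noteq> x" "z \<noteq> z'" by blast
  thus ?thesis
  proof cases
    case 1
    thus ?thesis using geodesic_value_edge[OF assms(3)] \<alpha>_antisym[of y x] by simp
  next
    case 2
    thus ?thesis using geodesic_value_edge[OF assms(1)] \<alpha>_antisym[of y x] by simp
  next
    case 3
    have "\<alpha>_length ([z, x, y] @ [hd [z, x, y]]) = 0"
      using 3 assms ne by (intro \<alpha>_length_closed) (auto simp: labelled_cycle_def)
    thus ?thesis using 3 geodesic_value_refl[of z] by (simp add: add.assoc)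
  next
    case 4
    have xz': "geodesic_value x z' (\<alpha> $ (x, y) + \<alpha> $ (y, z'))"
      using assms by (intro geodesic_value_two_edges)
    have zy: "geodesic_value z y (\<alpha> $ (z, x) + \<alpha> $ (x, y))"
      using assms by (intro geodesic_value_two_edges)
    obtain p where p: "p \<in> paths w z z'" "path_length d p = d z z'" "distinct p"
      by (rule geodesic_exists)
    consider "d z z' = d z x + d x z'" | "d z z' = d z y + d y z'"
      | "x \<notin> set p" "y \<notin> set p" "d z z' \<noteq> d z x + d x z'"
      using d_split_on_geodesic[OF p(1,2)] by blast
    thus ?thesis
    proof cases
      case 1
      thus ?thesis using geodesic_value_trans[OF geodesic_value_edge[OF assms(1)] xz']
        by (simp add: add.assoc)
    next
      case 2
      thus ?thesis using geodesic_value_trans[OF zy geodesic_value_edge[OF assms(3)]] by simp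
    next
      case 3
      \<comment> \<open>Failure of the split at \<open>x\<close> makes the inequality for
        \<open>X2\<close> strict.\<close>
      have lt: "d z' z < d z' y + d y x + d x z"
        using 3(3) d_triangle[of z z' x] d_triangle[of x z' y]
        by (simp add: d_sym[of z'] d_sym[of y x] d_sym[of x z] d_sym[of z' y])
      obtain r where r: "p = z # r @ [z']"
        using p(1) 4
        by (cases p; cases "tl p" rule: rev_cases) (auto simp: paths_def)
      define c where "c = z' # y # x # z # r"
      have "successively (adj w) ((z # r) @ [z'])" using p(1) r by (simp add: paths_def)
      hence "successively (adj w) (z # r)" "adj w (last (z # r)) z'"
        unfolding successively_append_iff by simp_all
      hence "labelled_cycle w c"
        using p(3) 3(1,2) ne assms unfolding c_def r
        by (auto simp: labelled_cycle_def adj_sym[of z' y] adj_sym[of y x] adj_sym[of x z])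
      moreover have "length c > 3 \<and>
           d (c ! 0) (c ! 3) < d (c ! 0) (c ! 1) + d (c ! 1) (c ! 2) + d (c ! 2) (c ! 3) \<and>
           path_length d (drop 3 c @ [c ! 0]) = d (c ! 3) (c ! 0)"
        using lt p(2) r by (simp add: c_def)
      ultimately have "\<alpha>_length (c @ [hd c]) = 0" by (intro \<alpha>_length_closed) auto
      hence "\<alpha>_length p = \<alpha> $ (z, x) + \<alpha> $ (x, y) + \<alpha> $ (y, z')"
        using \<alpha>_antisym[of z' y] \<alpha>_antisym[of y x] \<alpha>_antisym[of x z] by (simp add: c_def r)
      thus ?thesis using p unfolding geodesic_value_def by blast
    qed
  qed
qed

text \<open>The value 0 of \<alpha> on the diagonal lets the centres share the formula of their
  neighbours. Once \<alpha> is bounded by \<open>d\<close>, this makes the local primitive of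
  \<alpha> 1-Lipschitz across the two balls.\<close>

lemma geodesic_value_unit_balls:
  assumes "adj w x y" "z \<in> unit_ball x" "z' \<in> unit_ball y"
  shows "geodesic_value z z' (\<alpha> $ (z, x) + \<alpha> $ (x, y) + \<alpha> $ (y, z'))"
proof -
  have z: "z = x \<or> adj w z x" and z': "z' = y \<or> adj w y z'"
    using assms(2,3) by (auto simp: unit_ball_def adj_def w_sym[of x z])
  show ?thesis
    using z z' geodesic_value_three_edges[OF _ assms(1), of z z']
      geodesic_value_two_edges[OF _ assms(1), of z] geodesic_value_two_edges[OF assms(1), of z']
      geodesic_value_edge[OF assms(1)]
    by (elim disjE) simp_all
qed

end

section \<open>Tight edges and transport of tight walks\<close>

locale harmonic_form = closed_form w \<mu> d \<alpha>
  for w :: "'v::finite \<Rightarrow> 'v \<Rightarrow> real" and \<mu> d \<alpha> +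
  assumes coclosed: "codifferential w \<mu> \<alpha> x = 0"
    and \<alpha>_le_d: "\<alpha> $ (x, y) \<le> d x y"
    and curvature_nonneg: "nonneg_curvature w \<mu> d"
begin

text \<open>Coclosedness says that the primitive of \<alpha> along the edges at \<open>x\<close>,
  normalised to vanish at \<open>x\<close>, is harmonic there.\<close>

lemma laplacian_\<alpha> [simp]: "laplacian w \<mu> (\<lambda>z. \<alpha> $ (x, z)) x = 0"
proof -
  have "codifferential w \<mu> \<alpha> x = (\<Sum>y\<in>UNIV. w x y / \<mu> x * \<alpha> $ (x, y))"
    unfolding codifferential_def
  proof (rule sum.mono_neutral_left)
    show "\<forall>y\<in>UNIV - {y. adj w y x}. w x y / \<mu> x * \<alpha> $ (x, y) = 0"
      using \<alpha>_not_adj adj_sym[of x] by simp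
  qed auto
  thus ?thesis using coclosed[of x] by (simp add: laplacian_def)
qed

inductive tight_walk :: "'v \<Rightarrow> 'v \<Rightarrow> real \<Rightarrow> bool" where
  refl: "tight_walk x x 0"
| step: "adj w x y \<Longrightarrow> \<alpha> $ (x, y) = d x y \<Longrightarrow> tight_walk y z l \<Longrightarrow> tight_walk x z (d x y + l)"

lemma tight_walk_trans: "tight_walk x y l \<Longrightarrow> tight_walk y z m \<Longrightarrow> tight_walk x z (l + m)"
  by (induction rule: tight_walk.induct) (auto simp: add.assoc intro: tight_walk.step)

lemma tight_walk_edge: "adj w x y \<Longrightarrow> \<alpha> $ (x, y) = d x y \<Longrightarrow> tight_walk x y (d x y)"
  using tight_walk.step[OF _ _ tight_walk.refl, of x y] by simp

lemma \<alpha>_length_le: "\<alpha>_length p \<le> path_length d p"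
  by (induction p rule: induct_list012) (auto intro: add_mono \<alpha>_le_d)

lemma tight_walk_if_\<alpha>_length_eq:
  assumes "p \<noteq> []" "successively (adj w) p" "\<alpha>_length p = path_length d p"
  shows "tight_walk (hd p) (last p) (path_length d p)"
  using assms
proof (induction p rule: induct_list012)
  case (3 x y zs)
  have "\<alpha> $ (x, y) = d x y" "\<alpha>_length (y # zs) = path_length d (y # zs)"
    using 3(5) \<alpha>_le_d[of x y] \<alpha>_length_le[of "y # zs"] by simp_all
  thus ?case using 3 tight_walk.step[of x y "last (y # zs)" "path_length d (y # zs)"] by simp
qed (auto intro: tight_walk.refl)

lemma geodesic_value_le: "geodesic_value x y s \<Longrightarrow> s \<le> d x y"
  using \<alpha>_length_le by (auto simp: geodesic_value_def) metis

lemma tight_walk_if_geodesic_value: "geodesic_value x y (d x y) \<Longrightarrow> tight_walk x y (d x y)"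
  using tight_walk_if_\<alpha>_length_eq by (auto simp: geodesic_value_def paths_def) metis

text \<open>On a tight edge, these are the pairs at which the constraint of
  \<open>curvature_le_of_potentials\<close> is active for the local primitives; in transport terms,
  where an optimal plan may be supported.\<close>

definition tight_pair :: "'v \<Rightarrow> 'v \<Rightarrow> 'v \<Rightarrow> 'v \<Rightarrow> bool" where
  "tight_pair x y z z' \<longleftrightarrow> z \<in> unit_ball x \<and> z' \<in> unit_ball y \<and>
     \<alpha> $ (z, x) + \<alpha> $ (x, y) + \<alpha> $ (y, z') = d z z'"

lemma tight_walk_if_tight_pair: "adj w x y \<Longrightarrow> tight_pair x y z z' \<Longrightarrow> tight_walk z z' (d z z')"
  using geodesic_value_unit_balls[of x y z z'] tight_walk_if_geodesic_value[of z z']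
  by (auto simp: tight_pair_def)

text \<open>The local primitives are admissible potentials and harmonic at the centres, so they
  bound the curvature by 0.\<close>

lemma curvature_nonpos_on_tight_edge:
  assumes "adj w x y" "\<alpha> $ (x, y) = d x y"
  shows "curvature w \<mu> d x y \<le> 0"
proof -
  have "curvature w \<mu> d x y \<le>
      (laplacian w \<mu> (\<lambda>z. \<alpha> $ (x, z)) x - laplacian w \<mu> (\<lambda>z. d x y + \<alpha> $ (y, z)) y) / d x y"
  proof (rule curvature_le_of_potentials)
    show "d x y + \<alpha> $ (y, z') - \<alpha> $ (x, z) \<le> d z z'"
      if "z \<in> unit_ball x" "z' \<in> unit_ball y" for z z'
      using geodesic_value_le[OF geodesic_value_unit_balls[OF assms(1) that]] assms(2)
        \<alpha>_antisym[of z x] by simp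
  qed (use ne_if_adj[OF assms(1)] in auto)
  thus ?thesis by (simp add: laplacian_add)
qed

text \<open>
  Complementary slackness: the restrictions of a primitive of \<open>\<alpha>\<close> to the two balls are optimal
  potentials, so moving them by small multiples of \<open>a\<close> and \<open>b\<close> cannot violate \<open>\<kappa> \<ge> 0\<close>.
\<close>

lemma laplacian_ge_along_tight_edge:
  assumes xy: "adj w x y" "\<alpha> $ (x, y) = d x y"
    and ab: "\<And>z z'. tight_pair x y z z' \<Longrightarrow> b z' \<le> a z"
    and eq: "a x = b y"
  shows "laplacian w \<mu> b y \<le> laplacian w \<mu> a x"
proof -
  define A where "A \<epsilon> z = \<alpha> $ (x, z) + \<epsilon> * a z" for \<epsilon> z
  define B where "B \<epsilon> z = (d x y + \<alpha> $ (y, z)) + \<epsilon> * b z" for \<epsilon> z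
  \<comment> \<open>Tight pairs use the sign of \<open>b z' - a z\<close>; all others have slack at
    \<epsilon> = 0, which survives for small \<epsilon>.\<close>
  have ev: "eventually (\<lambda>\<epsilon>. B \<epsilon> z' - A \<epsilon> z \<le> d z z') (at_right 0)"
    if zz': "z \<in> unit_ball x" "z' \<in> unit_ball y" for z z'
  proof (cases "tight_pair x y z z'")
    case True
    have pos: "eventually (\<lambda>\<epsilon>::real. \<epsilon> > 0) (at_right 0)"
      by (rule eventually_at_right_less)
    show ?thesis
    proof (rule eventually_mono[OF pos])
      fix \<epsilon> :: real assume "\<epsilon> > 0"
      hence "\<epsilon> * b z' \<le> \<epsilon> * a z" using ab[OF True] by simp
      thus "B \<epsilon> z' - A \<epsilon> z \<le> d z z'"
        using True \<alpha>_antisym[of z x] xy(2) by (simp add: A_def B_def tight_pair_def)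
    qed
  next
    case False
    have "B 0 z' - A 0 z \<le> d z z'"
      using geodesic_value_le[OF geodesic_value_unit_balls[OF xy(1) zz']] xy(2)
        \<alpha>_antisym[of z x] by (simp add: A_def B_def)
    moreover have "B 0 z' - A 0 z \<noteq> d z z'"
      using False zz' xy(2) \<alpha>_antisym[of z x] by (simp add: A_def B_def tight_pair_def)
    ultimately have lt: "B 0 z' - A 0 z < d z z'" by simp
    have "((\<lambda>\<epsilon>. B \<epsilon> z' - A \<epsilon> z) \<longlongrightarrow> B 0 z' - A 0 z) (at_right 0)"
      unfolding A_def B_def by (intro tendsto_intros)
    from order_tendstoD(2)[OF this lt] show ?thesis by eventually_elim simp
  qed
  have "eventually (\<lambda>\<epsilon>. \<forall>z\<in>unit_ball x. \<forall>z'\<in>unit_ball y. B \<epsilon> z' - A \<epsilon> z \<le> d z z') (at_right 0)"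
    using ev by (intro eventually_ball_finite ballI) auto
  hence "eventually (\<lambda>\<epsilon>. \<epsilon> > 0 \<and>
      (\<forall>z\<in>unit_ball x. \<forall>z'\<in>unit_ball y. B \<epsilon> z' - A \<epsilon> z \<le> d z z')) (at_right 0)"
    by (intro eventually_conj eventually_at_right_less)
  then obtain \<epsilon> where \<epsilon>: "\<epsilon> > 0"
    and le: "\<And>z z'. z \<in> unit_ball x \<Longrightarrow> z' \<in> unit_ball y \<Longrightarrow> B \<epsilon> z' - A \<epsilon> z \<le> d z z'"
    using eventually_happens'[OF trivial_limit_at_right_real] by blast
  have "0 \<le> curvature w \<mu> d x y"
    using curvature_nonneg xy(1) by (simp add: nonneg_curvature_def)
  also have "\<dots> \<le> (laplacian w \<mu> (A \<epsilon>) x - laplacian w \<mu> (B \<epsilon>) y) / d x y"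
    using le eq ne_if_adj[OF xy(1)] by (intro curvature_le_of_potentials) (auto simp: A_def B_def)
  finally have "laplacian w \<mu> (B \<epsilon>) y \<le> laplacian w \<mu> (A \<epsilon>) x"
    using d_pos[OF ne_if_adj[OF xy(1)]] by (simp add: zero_le_divide_iff)
  hence "\<epsilon> * laplacian w \<mu> b y \<le> \<epsilon> * laplacian w \<mu> a x"
    unfolding A_def B_def by (simp add: laplacian_add laplacian_scale)
  thus ?thesis using \<epsilon> by simp
qed

text \<open>The centre is matched with \<open>y\<close>. A neighbour \<open>z\<close> without
  partner would enter no active constraint, so its potential could be lowered alone; this makes the
  Laplacian at \<open>x\<close> negative, against
  \<open>laplacian_ge_along_tight_edge\<close>.\<close>

lemma tight_pair_exists:
  assumes xy: "adj w x y" "\<alpha> $ (x, y) = d x y" and z: "z \<in> unit_ball x"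
  obtains z' where "tight_pair x y z z'"
proof (cases "z = x")
  case True
  thus ?thesis using that[of y] xy by (simp add: tight_pair_def unit_ball_def)
next
  case False
  show ?thesis
  proof (rule ccontr)
    assume none: "\<not> thesis"
    define a where "a u = (if u = z then - 1 else 0 :: real)" for u
    have "laplacian w \<mu> (\<lambda>_. 0) y \<le> laplacian w \<mu> a x"
    proof (rule laplacian_ge_along_tight_edge[OF xy])
      show "0 \<le> a u" if "tight_pair x y u u'" for u u'
        using that none \<open>\<And>z'. tight_pair x y z z' \<Longrightarrow> thesis\<close> by (auto simp: a_def)
    qed (use False in \<open>simp add: a_def\<close>)
    moreover have "laplacian w \<mu> a x < 0"
      using False z by (intro laplacian_strict_neg[of x a z]) (auto simp: a_def unit_ball_def)
    ultimately show False by simp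
  qed
qed

text \<open>Each tight edge is traded for a tight walk between matched vertices. The corrections by
  \<alpha> telescope, leaving only those at the two ends.\<close>

lemma tight_walk_transfer:
  assumes "tight_walk x y l" "z \<in> unit_ball x"
  shows "\<exists>z'\<in>unit_ball y. tight_walk z z' (\<alpha> $ (z, x) + l + \<alpha> $ (y, z'))"
  using assms
proof (induction arbitrary: z rule: tight_walk.induct)
  case (refl x)
  thus ?case using tight_walk.refl[of z] \<alpha>_antisym[of z x] by (intro bexI[of _ z]) auto
next
  case (step x y v l)
  obtain u where u: "tight_pair x y z u"
    using tight_pair_exists[OF step.hyps(1,2) step.prems] by blast
  hence "u \<in> unit_ball y" by (simp add: tight_pair_def)
  then obtain z' where z': "z' \<in> unit_ball v" "tight_walk u z' (\<alpha> $ (u, y) + l + \<alpha> $ (v, z'))"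
    using step.IH by blast
  have "tight_walk z z' (d z u + (\<alpha> $ (u, y) + l + \<alpha> $ (v, z')))"
    using tight_walk_trans[OF tight_walk_if_tight_pair[OF step.hyps(1) u] z'(2)] .
  moreover have "d z u = \<alpha> $ (z, x) + d x y - \<alpha> $ (u, y)"
    using u step.hyps(2) \<alpha>_antisym[of u y] by (simp add: tight_pair_def)
  ultimately show ?case using z'(1) by (intro bexI[of _ z']) (auto simp: algebra_simps)
qed

section \<open>Unbounded tight walks\<close>

definition long_walks :: "'v \<Rightarrow> bool" where
  "long_walks x \<longleftrightarrow> (\<forall>l. \<exists>y m. m \<ge> l \<and> tight_walk x y m)"

lemma long_walks_adj:
  assumes "long_walks x" "adj w x z"
  shows "long_walks z"
  unfolding long_walks_def
proof
  fix l
  \<comment> \<open>Antisymmetry turns \<alpha> \<le> \<open>d\<close> into the lower bound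
    \<open>- D\<close>, so an excess length of \<open>2 * D\<close> pays for both end
    corrections.\<close>
  define D where "D = Max (range (\<lambda>(u, v). d u v))"
  have "d u v \<le> D" for u v unfolding D_def by (rule Max_ge) auto
  hence D: "- D \<le> \<alpha> $ (u, v)" for u v
    using \<alpha>_le_d[of v u] \<alpha>_antisym[of v u] by (smt (verit))
  obtain y m where m: "m \<ge> l + 2 * D" "tight_walk x y m"
    using assms(1) unfolding long_walks_def by blast
  have "z \<in> unit_ball x" using assms(2) by (simp add: unit_ball_def)
  then obtain z' where z': "tight_walk z z' (\<alpha> $ (z, x) + m + \<alpha> $ (y, z'))"
    using tight_walk_transfer[OF m(2)] by blast
  have "l \<le> \<alpha> $ (z, x) + m + \<alpha> $ (y, z')" using m(1) D[of z x] D[of y z'] by linarith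
  thus "\<exists>y m. m \<ge> l \<and> tight_walk z y m" using z' by blast
qed

text \<open>
  If tight walks had bounded length, the maximal length \<open>h\<close> of a tight walk from a given vertex
  would have a Laplacian decreasing along longest walks, from a maximum of \<open>h\<close> to a zero of \<open>h\<close>.
  The maximum principle then makes \<open>h\<close> constant.
\<close>

lemma long_walks_exist:
  assumes "adj w x0 y0" "\<alpha> $ (x0, y0) = d x0 y0"
  shows "\<exists>x. long_walks x"
proof (rule ccontr)
  assume "\<nexists>x. long_walks x"
  hence ex_bound: "\<exists>l. \<forall>y m. tight_walk x y m \<longrightarrow> m < l" for x
    unfolding long_walks_def by (meson not_le)
  define W where "W x = {m. \<exists>y. tight_walk x y m}" for x
  define h where "h x = Sup (W x)" for x
  have bdd: "bdd_above (W x)" for x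
    using ex_bound[of x] unfolding W_def bdd_above_def by (blast intro: less_imp_le)
  have zero: "0 \<in> W x" for x unfolding W_def using tight_walk.refl by blast
  have h_nonneg: "0 \<le> h x" for x unfolding h_def by (rule cSup_upper[OF zero bdd])
  have h_walk: "l + h y \<le> h x" if "tight_walk x y l" for x y l
  proof -
    have "h y \<le> h x - l" unfolding h_def[of y]
    proof (rule cSup_least)
      fix m assume "m \<in> W y"
      hence "l + m \<in> W x" unfolding W_def using tight_walk_trans[OF that] by blast
      hence "l + m \<le> h x" unfolding h_def by (rule cSup_upper[OF _ bdd])
      thus "m \<le> h x - l" by simp
    qed (use zero in blast)
    thus ?thesis by simp
  qed
  have h_step: "\<exists>y. adj w x y \<and> \<alpha> $ (x, y) = d x y \<and> h x = d x y + h y" if "h x \<noteq> 0" for x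
  proof (rule ccontr)
    assume none: "\<nexists>y. adj w x y \<and> \<alpha> $ (x, y) = d x y \<and> h x = d x y + h y"
    \<comment> \<open>The entry 0 stands for the trivial walk. Only finitely many first edges
      compete, so the supremum is attained through one of them.\<close>
    define S where "S = insert 0 ((\<lambda>y. d x y + h y) ` {y. adj w x y \<and> \<alpha> $ (x, y) = d x y})"
    have S: "finite S" "S \<noteq> {}" by (simp_all add: S_def)
    have "s < h x" if "s \<in> S" for s
      using that none h_walk[OF tight_walk_edge, of x] h_nonneg[of x] \<open>h x \<noteq> 0\<close>
      unfolding S_def by (force simp: less_le)
    hence "Max S < h x" using S by simp
    moreover have "h x \<le> Max S" unfolding h_def
    proof (rule cSup_least)
      fix m assume "m \<in> W x"
      then obtain v where "tight_walk x v m" unfolding W_def by blast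
      thus "m \<le> Max S"
      proof cases
        case refl
        thus ?thesis using S by (intro Max_ge) (auto simp: S_def)
      next
        case (step y l)
        have "l \<le> h y" unfolding h_def using step(4)
          by (intro cSup_upper[OF _ bdd]) (auto simp: W_def)
        moreover have "d x y + h y \<le> Max S" using S step by (intro Max_ge) (auto simp: S_def)
        ultimately show ?thesis using step by simp
      qed
    qed (use zero in blast)
    ultimately show False by simp
  qed
  have decreasing: "laplacian w \<mu> h y \<le> laplacian w \<mu> h x"
    if xy: "adj w x y" "\<alpha> $ (x, y) = d x y" and hx: "h x = d x y + h y" for x y
  proof -
    \<comment> \<open>Tilting \<open>h\<close> by the two local primitives, whose Laplacians vanish
      at the centres, turns \<open>d z z' + h z' \<le> h z\<close> into the comparison needed on
      tight pairs.\<close>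
    have "laplacian w \<mu> (\<lambda>z. h z + (d x y + \<alpha> $ (y, z))) y
        \<le> laplacian w \<mu> (\<lambda>z. h z + \<alpha> $ (x, z)) x"
    proof (rule laplacian_ge_along_tight_edge[OF xy])
      fix z z' assume t: "tight_pair x y z z'"
      have "d z z' + h z' \<le> h z" by (rule h_walk[OF tight_walk_if_tight_pair[OF xy(1) t]])
      thus "h z' + (d x y + \<alpha> $ (y, z')) \<le> h z + \<alpha> $ (x, z)"
        using t xy(2) \<alpha>_antisym[of z x] by (simp add: tight_pair_def)
    qed (use hx in simp)
    thus ?thesis by (simp add: laplacian_add)
  qed
  \<comment> \<open>Along the first edges of longest walks, \<open>h\<close> strictly falls until it
    is 0 while its Laplacian never rises.\<close>
  have descend: "\<exists>v. h v = 0 \<and> laplacian w \<mu> h v \<le> laplacian w \<mu> h x" for x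
  proof (induction "card {u. h u < h x}" arbitrary: x rule: less_induct)
    case less
    show ?case
    proof (cases "h x = 0")
      case False
      then obtain y where y: "adj w x y" "\<alpha> $ (x, y) = d x y" "h x = d x y + h y"
        using h_step by blast
      have lt: "h y < h x" using y(3) d_pos[OF ne_if_adj[OF y(1)]] by simp
      hence "{u. h u < h y} \<subset> {u. h u < h x}" by auto
      hence "card {u. h u < h y} < card {u. h u < h x}" by (intro psubset_card_mono) auto
      from less[OF this] show ?thesis using decreasing[OF y] by force
    qed blast
  qed
  define H where "H = Max (range h)"
  have h_le: "h x \<le> H" for x unfolding H_def by (rule Max_ge) auto
  have "H \<in> range h" unfolding H_def by (rule Max_in) auto
  then obtain x where x: "h x = H" by auto
  have "h v = H" for v
  proof (rule adj_induct[of "\<lambda>v. h v = H", OF x])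
    fix u z assume u: "adj w u z" "h u = H"
    obtain v where v: "h v = 0" "laplacian w \<mu> h v \<le> laplacian w \<mu> h u"
      using descend by blast
    \<comment> \<open>A zero of \<open>h\<close> is a minimum, so the Laplacian is nonnegative
      there, and by \<open>descend\<close> also at the maximum \<open>u\<close>.\<close>
    have "laplacian w \<mu> (\<lambda>_. 0) v \<le> laplacian w \<mu> h v"
      using v(1) h_nonneg by (intro laplacian_mono) auto
    hence "0 \<le> laplacian w \<mu> h u" using v(2) by simp
    hence "\<not> h z < h u" using laplacian_strict_neg[of u h z] u h_le by force
    thus "h z = H" using u h_le[of z] by simp
  qed
  moreover obtain v where "h v = 0" using descend by blast
  \<comment> \<open>The constant value of \<open>h\<close> is 0, which the tight walk along the
    given edge contradicts.\<close>
  ultimately have "h x0 = 0" by metis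
  thus False
    using h_walk[OF tight_walk_edge[OF assms]] h_nonneg[of y0] d_pos[OF ne_if_adj[OF assms(1)]]
    by simp
qed

text \<open>Long walks spread from one vertex to all by connectedness, and a tight walk of length at
  least 1 has a first edge.\<close>

lemma tight_edge_everywhere:
  assumes "adj w x0 y0" "\<alpha> $ (x0, y0) = d x0 y0"
  shows "\<exists>y. adj w x y \<and> \<alpha> $ (x, y) = d x y"
proof -
  obtain x1 where "long_walks x1" using long_walks_exist[OF assms] by blast
  hence "long_walks x" by (rule adj_induct[of long_walks]) (rule long_walks_adj)
  then obtain y m where "m \<ge> 1" "tight_walk x y m" unfolding long_walks_def by blast
  from this(2) show ?thesis using \<open>m \<ge> 1\<close> by cases auto
qed

end

section \<open>Normalisation and conclusion\<close>

lemma (in connected_weighted_graph) H1_trivial: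
  assumes nonneg: "nonneg_curvature w \<mu> d"
    and x: "\<And>y. adj w y x \<Longrightarrow> curvature w \<mu> d x y > 0"
    and \<alpha>: "\<alpha> \<in> H1 w \<mu> d"
  shows "\<alpha> = 0"
proof (rule ccontr)
  assume "\<alpha> \<noteq> 0"
  interpret \<alpha>: closed_form w \<mu> d \<alpha>
    using \<alpha> by unfold_locales (auto simp: H1_def)
  \<comment> \<open>Dividing by the largest ratio of \<alpha> to \<open>d\<close> over the edges
    gives the bound by \<open>d\<close>, with equality on some edge.\<close>
  define R where "R = (\<lambda>(u, v). \<alpha> $ (u, v) / d u v) ` {(u, v). adj w u v}"
  define c where "c = Max R"
  obtain u v where uv: "\<alpha> $ (u, v) \<noteq> 0" using \<open>\<alpha> \<noteq> 0\<close> by (auto simp: vec_eq_iff)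
  have adj_uv: "adj w u v" using uv \<alpha>.\<alpha>_not_adj by blast
  have R: "finite R" "R \<noteq> {}" using adj_uv by (auto simp: R_def)
  have le_c: "\<alpha> $ (y, z) / d y z \<le> c" if "adj w y z" for y z
    unfolding c_def using R that by (intro Max_ge) (auto simp: R_def)
  \<comment> \<open>By antisymmetry a nonzero value is positive in one of the two
    orientations.\<close>
  have "c > 0"
  proof (cases "\<alpha> $ (u, v) > 0")
    case True
    hence "\<alpha> $ (u, v) / d u v > 0" using d_pos[OF ne_if_adj[OF adj_uv]] by simp
    thus ?thesis using le_c[OF adj_uv] by linarith
  next
    case False
    hence "\<alpha> $ (v, u) / d v u > 0"
      using d_pos[OF ne_if_adj[OF adj_uv]] uv \<alpha>.\<alpha>_antisym[of v u]
      by (simp add: d_sym[of v u] divide_less_0_iff)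
    thus ?thesis using le_c[of v u] adj_uv adj_sym[of u v] by simp
  qed
  define \<beta> where "\<beta> = (1 / c) *\<^sub>R \<alpha>"
  have "\<beta> \<in> H1 w \<mu> d" unfolding \<beta>_def using \<alpha> by (rule subspace_scale[OF subspace_H1])
  then interpret \<beta>: harmonic_form w \<mu> d \<beta>
  proof (unfold_locales, goal_cases)
    case (4 y z)
    show ?case
    proof (cases "adj w y z")
      case True
      thus ?thesis using le_c[OF True] \<open>c > 0\<close> d_pos[OF ne_if_adj[OF True]]
        by (simp add: \<beta>_def field_simps)
    next
      case False
      thus ?thesis using \<alpha>.\<alpha>_not_adj[OF False] d_nonneg by (simp add: \<beta>_def)
    qed
  qed (use nonneg in \<open>auto simp: H1_def\<close>)
  have "c \<in> R" unfolding c_def using R by (rule Max_in)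
  then obtain x0 y0 where xy0: "adj w x0 y0" "c = \<alpha> $ (x0, y0) / d x0 y0"
    unfolding R_def by auto
  have "\<beta> $ (x0, y0) = d x0 y0"
    using xy0(2) \<open>c > 0\<close> d_pos[OF ne_if_adj[OF xy0(1)]] by (simp add: \<beta>_def field_simps)
  \<comment> \<open>The scaled form has a tight edge at \<open>x\<close>, where positive curvature
    contradicts \<open>curvature_nonpos_on_tight_edge\<close>.\<close>
  then obtain y where "adj w x y" "\<beta> $ (x, y) = d x y"
    using \<beta>.tight_edge_everywhere[OF xy0(1)] by blast
  thus False using \<beta>.curvature_nonpos_on_tight_edge x[of y] adj_sym[of x y] by force
qed

theorem theorem3p5:
  fixes w :: "'v::finite \<Rightarrow> 'v \<Rightarrow> real"
    and \<mu> :: "'v \<Rightarrow> real"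
    and d :: "'v \<Rightarrow> 'v \<Rightarrow> real"
  assumes "connected_weighted_graph w \<mu> d"
    and "nonneg_curvature w \<mu> d"
    and "\<exists>x. \<forall>y\<in>S1_comb w x. curvature w \<mu> d x y > 0"
  shows "betti1 w \<mu> d = 0"
proof -
  obtain x where "\<And>y. adj w y x \<Longrightarrow> curvature w \<mu> d x y > 0"
    using assms(3) by (auto simp: S1_comb_def)
  hence "H1 w \<mu> d \<subseteq> {0}"
    using connected_weighted_graph.H1_trivial[OF assms(1,2)] by blast
  thus ?thesis by (simp add: betti1_def dim_eq_0)
qed

end
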